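(* Let $N\ge 2$ and let $\pi=[x_0,x_1,\ldots,x_{N-1}]\in\mathcal{S}_N$ (meaning $\pi(i)=x_i$). For $\alpha=N-1,N-2,\ldots,1$ successively, let $l_\alpha$ be the position (counted from $0$) of the element $\alpha$ in the current array, and then update the array by deleting the entry $\alpha$ (starting from the array $[x_0,\ldots,x_{N-1}]$). Then $$\pi=\prod_{\alpha=1}^{N-1}\Pi_{\alpha-1}\big((\alpha+1)-l_\alpha\big)=\Pi_0(2-l_1)\,\Pi_1(3-l_2)\cdots\Pi_{N-2}(N-l_{N-1}),$$ which is a decomposition of $\pi$ as a product of adjacent transpositions. The worst-case time complexity of this procedure is $O(N^2)$.
   Context: $\mathcal{S}_N$ is the group of permutations of $\{0,1,\ldots,N-1\}$ and $s_j=(j,j+1)$, $0\le j\le N-2$, are the adjacent transpositions. Products are compositions with the right factor applied first, so multiplying $\pi$ on the right by $s_j$ interchanges the $j$-th and $(j+1)$-th entries of the array $[\pi(0),\ldots,\pi(N-1)]$. For $0\le k\le N-2$, $\Pi_k$ is the ordered set $$\Pi_k=\{I,\ s_k,\ s_ks_{k-1},\ \ldots,\ s_ks_{k-1}\cdots s_0\}$$ with $k+2$ elements, and $\Pi_k(m)$ denotes its $m$-th element, $m=1,\ldots,k+2$ (so $\Pi_k(1)=I$, $\Pi_k(2)=s_k$, ..., $\Pi_k(k+2)=s_ks_{k-1}\cdots s_0$). For time complexity, locating and removing an element in an unsorted array of $\alpha+1$ entries costs $O(\alpha+1)$. *)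

theory Defs
  imports Complex_Main "HOL-Combinatorics.Permutations" "HOL-Library.Landau_Symbols"
begin

definition adj :: "nat \<Rightarrow> nat \<Rightarrow> nat" where
  "adj j = Transposition.transpose j (j + 1)"

definition perm_prod :: "(nat \<Rightarrow> nat) list \<Rightarrow> nat \<Rightarrow> nat" where
  "perm_prod fs = foldr (\<circ>) fs id"

(* The indices k, k-1, ... of the first r factors of the word s_k s_{k-1} ... s_0. *)
definition desc_word :: "nat \<Rightarrow> nat \<Rightarrow> nat list" where
  "desc_word k r = take r (rev [0..<k + 1])"

(* The ordered set I, s_k, s_k s_{k-1}, ..., s_k ... s_0, with k + 2 entries. *)
definition Pi_list :: "nat \<Rightarrow> (nat \<Rightarrow> nat) list" where
  "Pi_list k = map (\<lambda>r. perm_prod (map adj (desc_word k r))) [0..<k + 2]"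

(* Elements of the ordered set are counted from 1. *)
definition Pi_elem :: "nat \<Rightarrow> nat \<Rightarrow> nat \<Rightarrow> nat" where
  "Pi_elem k m = Pi_list k ! (m - 1)"

definition array_of :: "nat \<Rightarrow> (nat \<Rightarrow> nat) \<Rightarrow> nat list" where
  "array_of N p = map p [0..<N]"

definition position :: "nat \<Rightarrow> nat list \<Rightarrow> nat" where
  "position a A = (LEAST i. i < length A \<and> A ! i = a)"

(* The array in which a is located: N-1, N-2, ..., a+1 have been deleted, in this order. *)
definition current_array :: "nat list \<Rightarrow> nat \<Rightarrow> nat list" where
  "current_array xs a = fold remove1 (rev [a + 1..<length xs]) xs"

definition pos_at :: "nat list \<Rightarrow> nat \<Rightarrow> nat" where
  "pos_at xs a = position a (current_array xs a)"

definition stage_word :: "nat list \<Rightarrow> nat \<Rightarrow> nat list" where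
  "stage_word xs a = desc_word (a - 1) (a - pos_at xs a)"

definition decomp_word :: "nat list \<Rightarrow> nat list" where
  "decomp_word xs = concat (map (stage_word xs) [1..<length xs])"

(* Running time on the input array xs.  The parameter c A a is the cost of locating and
   removing a in the array A; u is the cost of one elementary operation.  Besides the
   location and removal, each stage is charged u for determining the element of the
   ordered set and u for every adjacent transposition written out. *)
definition run_time :: "(nat list \<Rightarrow> nat \<Rightarrow> real) \<Rightarrow> real \<Rightarrow> nat list \<Rightarrow> real" where
  "run_time c u xs =
     (\<Sum>a = 1..<length xs. c (current_array xs a) a + u * (1 + real (length (stage_word xs a))))"

definition worst_time :: "(nat list \<Rightarrow> nat \<Rightarrow> real) \<Rightarrow> real \<Rightarrow> nat \<Rightarrow> real" where
  "worst_time c u N = Max ((\<lambda>p. run_time c u (array_of N p)) ` {p. p permutes {0..<N}})"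

end

theory Submission
  imports Defs
begin

text \<open>Read an array as the permutation that fixes every index beyond its end. Deleting the
  maximal entry \<open>\<alpha>\<close> at position \<open>l\<close> then amounts to splitting off the right factor
  \<open>s\<^bsub>\<alpha>-1\<^esub> \<dots> s\<^sub>l\<close>, the cycle that carries \<open>l\<close> to \<open>\<alpha>\<close> and shifts \<open>l+1, \<dots>, \<alpha>\<close> down by one. After all
  deletions the array \<open>[0]\<close>, i.e. the identity, is left. Stage \<open>\<alpha>\<close> costs \<open>O(\<alpha> + 1)\<close>, which sums
  to \<open>O(N\<^sup>2)\<close>.\<close>

section \<open>Words in adjacent transpositions and the ordered sets\<close>

lemma perm_prod_Nil [simp]: "perm_prod [] = id"
  and perm_prod_Cons [simp]: "perm_prod (f # fs) = f \<circ> perm_prod fs"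
  by (simp_all add: perm_prod_def)

lemma perm_prod_append: "perm_prod (fs @ gs) = perm_prod fs \<circ> perm_prod gs"
  by (induction fs) (simp_all add: comp_assoc)

lemma perm_prod_concat: "perm_prod (concat fss) = perm_prod (map perm_prod fss)"
  by (induction fss) (simp_all add: perm_prod_append)

lemma desc_word_eq:
  assumes "l \<le> a" "0 < a"
  shows "desc_word (a - 1) (a - l) = rev [l..<a]"
  using assms by (simp add: desc_word_def take_rev)

text \<open>Extending \<open>a\<close> to \<open>Suc a\<close> puts \<open>adj a\<close> in front.
  The shorter product sends \<open>l\<close> to \<open>a\<close> and fixes \<open>Suc a\<close>, and
  \<open>adj a\<close>, applied last, swaps just these two values.\<close>

lemma perm_prod_adj_rev_upt:
  assumes "l \<le> a"
  shows "perm_prod (map adj (rev [l..<a])) i =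
    (if i = l then a else if l < i \<and> i \<le> a then i - 1 else i)"
  using assms by (induction a rule: dec_induct) (auto simp: adj_def Transposition.transpose_def)

text \<open>Counting from 1 makes the element numbered \<open>a + 1 - l\<close> the one with
  \<open>a - l\<close> factors, namely the indices from \<open>a - 1\<close> down to
  \<open>l\<close>.\<close>

lemma Pi_elem_eq:
  assumes "l \<le> a" "0 < a"
  shows "Pi_elem (a - 1) (a + 1 - l) = perm_prod (map adj (rev [l..<a]))"
proof -
  have "Pi_elem (a - 1) (a + 1 - l) = perm_prod (map adj (desc_word (a - 1) (a - l)))"
    using assms by (simp add: Pi_elem_def Pi_list_def less_Suc_eq_le del: upt_Suc)
  then show ?thesis
    using desc_word_eq[OF assms] by simp
qed

section \<open>Arrays as permutations, deletion and position of an entry\<close>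

definition array_fun :: "nat list \<Rightarrow> nat \<Rightarrow> nat" where
  "array_fun A i = (if i < length A then A ! i else i)"

lemma array_fun_array_of: "p permutes {0..<N} \<Longrightarrow> array_fun (array_of N p) = p"
  by (auto simp: array_fun_def array_of_def permutes_def)

text \<open>Compare entries: indices below \<open>l\<close> are untouched, those in
  \<open>l < i \<le> a\<close> find their entry one place to the left after the deletion, and
  \<open>l\<close> is sent to \<open>a\<close>. That index is just past the end of the shortened
  array, so the default value of \<open>array_fun\<close> supplies the deleted entry
  \<open>a\<close>.\<close>

lemma array_fun_remove1:
  assumes "distinct A" "length A = a + 1" "l \<le> a" "A ! l = a"
  shows "array_fun A = array_fun (remove1 a A) \<circ> perm_prod (map adj (rev [l..<a]))"
proof -
  obtain B C where A: "A = B @ a # C" and l: "length B = l"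
    using assms id_take_nth_drop[of l A] by (intro that[of "take l A" "drop (Suc l) A"]) simp_all
  \<comment> \<open>Distinctness keeps \<open>a\<close> out of \<open>B\<close>, so the first
    occurrence is the one at \<open>l\<close>.\<close>
  then have "remove1 a A = B @ C"
    using assms(1) by (simp add: remove1_append)
  then show ?thesis
    using assms(2,3) A l
    by (auto simp: fun_eq_iff perm_prod_adj_rev_upt array_fun_def nth_append nth_Cons')
qed

lemma distinct_fold_remove1: "distinct xs \<Longrightarrow> distinct (fold remove1 ys xs)"
  by (induction ys arbitrary: xs) auto

lemma set_fold_remove1: "distinct xs \<Longrightarrow> set (fold remove1 ys xs) = set xs - set ys"
  by (induction ys arbitrary: xs) auto

lemma position_nth:
  assumes "a \<in> set A"
  shows "position a A < length A" "A ! position a A = a"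
proof -
  from assms obtain i where "i < length A \<and> A ! i = a"
    by (auto simp: in_set_conv_nth)
  then have "position a A < length A \<and> A ! position a A = a"
    unfolding position_def by (rule LeastI)
  then show "position a A < length A" "A ! position a A = a"
    by blast+
qed

section \<open>Deleting the maxima one by one\<close>

context
  fixes N :: nat and xs :: "nat list"
  assumes distinct_xs: "distinct xs" and set_xs: "set xs = {0..<N}"
begin

lemma length_xs: "length xs = N"
  using distinct_card[OF distinct_xs] set_xs by simp

lemma current_array_last: "current_array xs (N - 1) = xs"
  by (simp add: current_array_def length_xs)

lemma current_array_pred:
  assumes "0 < a" "a < N"
  shows "current_array xs (a - 1) = remove1 a (current_array xs a)"
  \<comment> \<open>Splitting \<open>[a..<N]\<close> at its lower end makes \<open>a\<close>, after
    reversal, the last deletion of the fold.\<close>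
  using assms by (simp add: current_array_def length_xs upt_conv_Cons)

lemma distinct_current_array: "distinct (current_array xs a)"
  by (simp add: current_array_def distinct_fold_remove1 distinct_xs)

lemma set_current_array: "a < N \<Longrightarrow> set (current_array xs a) = {0..a}"
  by (auto simp: current_array_def set_fold_remove1 distinct_xs set_xs length_xs)

lemma length_current_array: "a < N \<Longrightarrow> length (current_array xs a) = a + 1"
  using distinct_card[OF distinct_current_array[of a]] by (simp add: set_current_array)

lemma pos_at_le: "a < N \<Longrightarrow> pos_at xs a \<le> a"
  and nth_pos_at: "a < N \<Longrightarrow> current_array xs a ! pos_at xs a = a"
  using position_nth[of a "current_array xs a"]
  by (simp_all add: pos_at_def set_current_array length_current_array)

lemma stage_word_eq:
  assumes "0 < a" "a < N"
  shows "stage_word xs a = rev [pos_at xs a..<a]"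
  unfolding stage_word_def by (rule desc_word_eq) (use assms pos_at_le in auto)

text \<open>The induction runs against the procedure: it starts from the final array
  \<open>[0]\<close> and undoes one deletion per step, which appends one factor on the
  right.\<close>

lemma array_fun_current_array:
  assumes "a < N"
  shows "array_fun (current_array xs a) =
    perm_prod (map (\<lambda>b. perm_prod (map adj (stage_word xs b))) [1..<a + 1])"
  using assms
proof (induction a)
  case 0
  have "length (current_array xs 0) = Suc 0" "set (current_array xs 0) = {0}"
    using length_current_array[OF 0] set_current_array[OF 0] by simp_all
  then have "current_array xs 0 = [0]"
    by (cases "current_array xs 0") simp_all
  then show ?case
    by (auto simp: array_fun_def)
next
  case (Suc a)
  let ?W = "\<lambda>b. perm_prod (map adj (stage_word xs b))"
  note prems = Suc.prems
  have remove: "remove1 (Suc a) (current_array xs (Suc a)) = current_array xs a"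
    using current_array_pred[OF _ prems] by simp
  have "array_fun (current_array xs (Suc a)) =
      array_fun (remove1 (Suc a) (current_array xs (Suc a))) \<circ>
      perm_prod (map adj (rev [pos_at xs (Suc a)..<Suc a]))"
    by (rule array_fun_remove1[OF distinct_current_array length_current_array[OF prems]
          pos_at_le[OF prems] nth_pos_at[OF prems]])
  also have "\<dots> = perm_prod (map ?W [1..<a + 1]) \<circ> ?W (Suc a)"
    unfolding remove stage_word_eq[OF zero_less_Suc prems] Suc.IH[OF Suc_lessD[OF prems]] ..
  also have "\<dots> = perm_prod (map ?W [1..<Suc a + 1])"
    by (simp add: perm_prod_append)
  finally show ?case .
qed

lemma array_fun_eq_perm_prod:
  assumes "0 < N"
  shows "array_fun xs = perm_prod (map (\<lambda>a. perm_prod (map adj (stage_word xs a))) [1..<N])"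
  \<comment> \<open>At \<open>N - 1\<close> nothing has been deleted yet, so the array is the
    input.\<close>
  using array_fun_current_array[of "N - 1", unfolded current_array_last] assms by simp

lemma array_fun_eq_prod_Pi_elem:
  assumes "0 < N"
  shows "array_fun xs = perm_prod (map (\<lambda>a. Pi_elem (a - 1) (a + 1 - pos_at xs a)) [1..<N])"
  unfolding array_fun_eq_perm_prod[OF assms]
  by (rule arg_cong[where f = perm_prod], rule map_cong)
    (simp_all add: stage_word_eq Pi_elem_eq pos_at_le del: One_nat_def)

lemma array_fun_eq_decomp_word:
  assumes "0 < N"
  shows "array_fun xs = perm_prod (map adj (decomp_word xs))"
  using array_fun_eq_perm_prod[OF assms]
  by (simp add: decomp_word_def map_concat perm_prod_concat length_xs comp_def)

lemma set_decomp_word: "set (decomp_word xs) \<subseteq> {0..N - 2}"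
  by (auto simp: decomp_word_def length_xs stage_word_eq)

text \<open>There are fewer than \<open>N\<close> stages, and each costs at most
  \<open>(C + u) * real N\<close>. The constant depends neither on \<open>N\<close> nor on the
  input.\<close>

lemma run_time_bounds:
  assumes cost: "\<And>A a. a \<in> set A \<Longrightarrow> 0 \<le> c A a \<and> c A a \<le> f (length A)"
    and f: "\<And>n. 1 \<le> n \<Longrightarrow> f n \<le> C * real n"
    and "0 \<le> u" "0 \<le> C"
  shows "0 \<le> run_time c u xs" "run_time c u xs \<le> (C + u) * real N ^ 2"
proof -
  define t where "t a = c (current_array xs a) a + u * (1 + real (length (stage_word xs a)))" for a
  have run: "run_time c u xs = (\<Sum>a = 1..<N. t a)"
    by (simp add: run_time_def t_def length_xs)
  have t: "0 \<le> t a \<and> t a \<le> (C + u) * real N" if "a \<in> {1..<N}" for a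
  proof -
    have a: "0 < a" "a < N"
      using that by auto
    have c: "0 \<le> c (current_array xs a) a \<and> c (current_array xs a) a \<le> f (a + 1)"
      using cost[of a "current_array xs a"] a by (simp add: set_current_array length_current_array)
    have "f (a + 1) \<le> C * real (a + 1)"
      by (rule f) simp
    also have "\<dots> \<le> C * real N"
      using a \<open>0 \<le> C\<close> by (intro mult_left_mono) auto
    finally have "c (current_array xs a) a \<le> C * real N"
      using c by linarith
    \<comment> \<open>The word has \<open>a - l \<le> a\<close> letters for
      \<open>l = pos_at xs a\<close>; with the extra unit this gives at most
      \<open>a + 1 \<le> N\<close>.\<close>
    moreover have "u * (1 + real (length (stage_word xs a))) \<le> u * real N"
      using a \<open>0 \<le> u\<close> by (intro mult_left_mono) (auto simp: stage_word_eq)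
    ultimately show ?thesis
      using c \<open>0 \<le> u\<close> by (simp add: t_def distrib_right)
  qed
  show "0 \<le> run_time c u xs"
    unfolding run by (rule sum_nonneg) (use t in blast)
  have "run_time c u xs \<le> real (card {1..<N}) * ((C + u) * real N)"
    unfolding run by (rule sum_bounded_above) (use t in blast)
  also have "\<dots> \<le> real N * ((C + u) * real N)"
    using assms by (intro mult_right_mono) auto
  finally show "run_time c u xs \<le> (C + u) * real N ^ 2"
    by (simp add: power2_eq_square mult_ac)
qed

end

section \<open>From single runs to the worst case\<close>

lemma array_of_permutes:
  assumes "p permutes {0..<N}"
  shows "distinct (array_of N p)" "set (array_of N p) = {0..<N}"
  using permutes_inj_on[OF assms] permutes_image[OF assms]
  by (simp_all add: array_of_def distinct_map)

text \<open>Arrays of every positive length occur, so the eventual bound must hold from 1 on; the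
  finitely many exceptions are absorbed into the constant. At 0 the right side vanishes and no
  constant could help.\<close>

lemma linear_bigo_bound:
  fixes f :: "nat \<Rightarrow> real"
  assumes "f \<in> O(\<lambda>n. real n)"
  obtains C where "0 \<le> C" "\<And>n. 1 \<le> n \<Longrightarrow> f n \<le> C * real n"
proof -
  obtain K where "K > 0" and "eventually (\<lambda>n. norm (f n) \<le> K * norm (real n)) sequentially"
    using landau_o.bigE[OF assms] by blast
  then obtain m where m: "\<And>n. m \<le> n \<Longrightarrow> norm (f n) \<le> K * norm (real n)"
    unfolding eventually_sequentially by blast
  \<comment> \<open>\<open>S\<close> dominates every value of \<open>f\<close> below the threshold,
    and \<open>S \<le> S * real n\<close> once \<open>n \<ge> 1\<close>.\<close>
  define S where "S = (\<Sum>n<m. \<bar>f n\<bar>)"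
  have "0 \<le> S"
    by (simp add: S_def sum_nonneg)
  have "f n \<le> (K + S) * real n" if "1 \<le> n" for n
  proof (cases "n < m")
    case True
    then have "\<bar>f n\<bar> \<le> S"
      unfolding S_def by (intro member_le_sum) auto
    also have "S \<le> S * real n"
      using \<open>0 \<le> S\<close> that by (simp add: mult_le_cancel_left1)
    finally have "f n \<le> S * real n"
      by linarith
    moreover have "0 \<le> K * real n"
      using \<open>K > 0\<close> by simp
    ultimately show ?thesis
      unfolding distrib_right by linarith
  next
    case False
    then have "f n \<le> K * real n"
      using m[of n] by simp
    moreover have "0 \<le> S * real n"
      using \<open>0 \<le> S\<close> by simp
    ultimately show ?thesis
      unfolding distrib_right by linarith
  qed
  then show thesis
    using \<open>0 \<le> S\<close> \<open>K > 0\<close> by (intro that[of "K + S"]) auto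
qed

lemma worst_time_bigo:
  fixes c :: "nat list \<Rightarrow> nat \<Rightarrow> real" and f :: "nat \<Rightarrow> real" and u :: real
  assumes cost: "\<And>A a. a \<in> set A \<Longrightarrow> 0 \<le> c A a \<and> c A a \<le> f (length A)"
    and linear: "f \<in> O(\<lambda>n. real n)"
    and unit: "0 \<le> u"
  shows "worst_time c u \<in> O(\<lambda>N. real N ^ 2)"
proof -
  obtain C where "0 \<le> C" and f: "\<And>n. 1 \<le> n \<Longrightarrow> f n \<le> C * real n"
    using linear_bigo_bound[OF linear] by blast
  have "norm (worst_time c u N) \<le> (C + u) * norm (real N ^ 2)" for N
  proof -
    let ?T = "(\<lambda>p. run_time c u (array_of N p)) ` {p. p permutes {0..<N}}"
    \<comment> \<open>The maximum over a finite set, nonempty because of the identity, is attained,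
      so the bounds for one run apply to it.\<close>
    have "worst_time c u N \<in> ?T"
      unfolding worst_time_def
      by (rule Max_in) (auto intro: finite_permutations permutes_id)
    then obtain p where p: "p permutes {0..<N}"
      and w: "worst_time c u N = run_time c u (array_of N p)"
      by blast
    show ?thesis
      unfolding w using run_time_bounds[OF array_of_permutes[OF p] cost f unit \<open>0 \<le> C\<close>] by simp
  qed
  then show ?thesis
    by (intro bigoI[where c = "C + u"] always_eventually allI)
qed

theorem mainTheorem5:
  fixes c :: "nat list \<Rightarrow> nat \<Rightarrow> real" and f :: "nat \<Rightarrow> real" and u :: real
  assumes cost: "\<And>A a. a \<in> set A \<Longrightarrow> 0 \<le> c A a \<and> c A a \<le> f (length A)"
    and linear: "f \<in> O(\<lambda>n. real n)"
    and unit: "0 \<le> u"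
  shows "(\<forall>N \<pi>. N \<ge> 2 \<longrightarrow> \<pi> permutes {0..<N} \<longrightarrow>
            (let xs = array_of N \<pi>; l = pos_at xs in
               (\<forall>\<alpha>\<in>{1..N - 1}. length (current_array xs \<alpha>) = \<alpha> + 1 \<and> l \<alpha> \<le> \<alpha> \<and>
                                current_array xs \<alpha> ! l \<alpha> = \<alpha>) \<and>
               \<pi> = perm_prod (map (\<lambda>\<alpha>. Pi_elem (\<alpha> - 1) ((\<alpha> + 1) - l \<alpha>)) [1..<N]) \<and>
               set (decomp_word xs) \<subseteq> {0..N - 2} \<and>
               \<pi> = perm_prod (map adj (decomp_word xs))))
       \<and> worst_time c u \<in> O(\<lambda>N. real N ^ 2)"
proof (intro conjI allI impI)
  fix N :: nat and \<pi> :: "nat \<Rightarrow> nat"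
  assume N: "N \<ge> 2" and \<pi>: "\<pi> permutes {0..<N}"
  note xs = array_of_permutes[OF \<pi>]
  \<comment> \<open>Since \<open>\<pi>\<close> fixes every index from \<open>N\<close> on, the array
    determines it on all naturals.\<close>
  have eq: "array_fun (array_of N \<pi>) = \<pi>"
    by (rule array_fun_array_of[OF \<pi>])
  have "0 < N"
    using N by simp
  have "\<alpha> < N" if "\<alpha> \<in> {1..N - 1}" for \<alpha>
    using that N by auto
  note stage = length_current_array[OF xs this] pos_at_le[OF xs this] nth_pos_at[OF xs this]
  show "let xs = array_of N \<pi>; l = pos_at xs in
      (\<forall>\<alpha>\<in>{1..N - 1}. length (current_array xs \<alpha>) = \<alpha> + 1 \<and> l \<alpha> \<le> \<alpha> \<and>
                       current_array xs \<alpha> ! l \<alpha> = \<alpha>) \<and>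
      \<pi> = perm_prod (map (\<lambda>\<alpha>. Pi_elem (\<alpha> - 1) ((\<alpha> + 1) - l \<alpha>)) [1..<N]) \<and>
      set (decomp_word xs) \<subseteq> {0..N - 2} \<and>
      \<pi> = perm_prod (map adj (decomp_word xs))"
    unfolding Let_def
    by (intro conjI ballI stage set_decomp_word[OF xs] \<open>0 < N\<close>
        array_fun_eq_prod_Pi_elem[OF xs, unfolded eq] array_fun_eq_decomp_word[OF xs, unfolded eq])
next
  show "worst_time c u \<in> O(\<lambda>N. real N ^ 2)"
    by (rule worst_time_bigo[OF assms])
qed

end
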